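(* Let $\mathcal{C}=\mathrm{Corridor}(u,l,D)$ be an $\mathbb{R}^m$-corridor, let $X\subset D$ be a finite set, and let $H=(X,E)$ be an incompatibility hypergraph for $\mathcal{C}$. Let $z_{CFP}$, $z_{DCFP}$, $z_{color}$, $z_{MumC}$, $z_{MalC}$ denote the optimal values of, respectively, the Corridor Fitting Problem in $\mathbb{R}^m$ on $\mathcal{C}$ and the problems $(\mathcal{R}^{\mathrm{DCFP}})$, $(\mathcal{R}^{\mathrm{color}})$, $(\mathcal{R}^{\mathrm{MumC}})$, $(\mathcal{R}^{\mathrm{MalC}})$ for $(\mathcal{C},X,H)$. Then $$z_{CFP}\ \ge\ z_{DCFP}\ \ge\ z_{color}\ \ge\ z_{MumC}\ \ge\ z_{MalC}.$$
   Context: "Linear function" means affine function $x\mapsto a^Tx+b$ with $a\in\mathbb{R}^m$, $b\in\mathbb{R}$. Polytopes are compact; $\mathrm{int}$, $\mathrm{bd}$ and $\mathrm{conv}$ denote interior, boundary and convex hull. Corridor: let $D\subset\mathbb{R}^m$ be a full-dimensional polytope and $u,l:D\to\mathbb{R}$ continuous functions with $l(x)<u(x)$ for all $x\in D$. The $\mathbb{R}^m$-corridor between $u$ and $l$ of domain $D$ is $\mathrm{Corridor}(u,l,D)=\{(x,z)\in\mathbb{R}^{m+1} : x\in D,\ l(x)\le z\le u(x)\}$ (given together with the data $u,l,D$). Piecewise linear function with $n$ pieces and domain $D$ ($n\ge 1$ an integer): given full-dimensional polytopes $D_1,\dots,D_n\subset\mathbb{R}^m$ covering $D$ with pairwise disjoint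 interiors, and linear functions $l_i:D_i\to\mathbb{R}$, it is the function $g$ on $D$ with $g(x)=l_i(x)$ if $x\in\mathrm{int}(D_i)$, and, if $x$ lies on the boundary of some $D_i$, $g(x)=\min\{l_i(x): i \text{ with } x\in D_i\}$. Corridor Fitting Problem in $\mathbb{R}^m$ ($\mathbb{R}^m$-CFP) on $\mathrm{Corridor}(u,l,D)$: find a piecewise linear function $g$ with domain $D$ with the minimum number $n$ of pieces subject to $l(x)\le g(x)\le u(x)$ for all $x\in D$. Its optimal value is this minimum number of pieces. Linearly compatible set: a finite set $s\subset D$ is linearly compatible (for $\mathrm{Corridor}(u,l,D)$) if there is a linear function $L$ with $l(x)\le L(x)\le u(x)$ for all $x\in\mathrm{conv}(s)$; otherwise it is not linearly compatible. Hypergraph and coloring: a hypergraph $(V,E)$ has a finite vertex set $V$ and a set $E$ of edges, each edge being a subset of $V$ (possibly with more than two vertices). An $n$-coloring of $(V,E)$ is a function $c:V\to\{1,\dots,n\}$ such that for every edge $e\in E$ not all vertices of $e$ have the same color. Incompatibility hypergraph for $\mathcal{C}$: a hypergraph $H=(X,E)$ with $X\subset D$ finite, each of whose edges is a subset of $X$ that is not linearly compatible for $\mathcal{C}$ (not every such subset needs to be an edge). Problem $(\mathcal{R}^{\mathrm{color}})$: color $H$ (i.e. find an $n$-coloring $c:X\to\{1,\dots,n\}$ such that for every edge $e\in E$ not all vertices of $e$ have the same color) with the minimum number of colors; its optimal value is this minimum. Problem $(\mathcal{R}^{\mathrm{DCFP}})$: find a coloring of $H$ minimizing the number of colors, subject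 to: (i) each color $j$ is associated with a linear function $L_j(x)=a_jx+b_j$, $a_j\in\mathbb{R}^m$, $b_j\in\mathbb{R}$, defined on the domain $D_j=\mathrm{conv}(\{x_i\in X : x_i \text{ is of color } j\})$; (ii) the interiors of the domains $D_j$ do not intersect; (iii) each point $x_i\in X$ of color $j$ satisfies $l(x_i)\le L_j(x_i)\le u(x_i)$. Its optimal value is the minimum number of colors. Let $G$ be the graph obtained from $H$ by removing every edge with at least three vertices. Problem $(\mathcal{R}^{\mathrm{MumC}})$: find a clique of maximum cardinality in $G$; its optimal value is that cardinality. Problem $(\mathcal{R}^{\mathrm{MalC}})$: find a maximal clique of $G$, i.e. a clique that is not a proper subset of another clique of $G$; its value $z_{MalC}$ is the cardinality of the maximal clique found (any maximal clique is a solution). *)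

theory Defs
  imports "HOL-Analysis.Analysis" "HOL-Library.Extended_Nat" "HOL-Library.Ramsey"
begin

section \<open>Corridors and piecewise linear functions\<close>

definition full_dim_polytope :: "(real ^ 'm) set \<Rightarrow> bool" where
  "full_dim_polytope P \<longleftrightarrow> polytope P \<and> aff_dim P = int CARD('m)"

text \<open>A corridor is the set of all \<open>(x, z)\<close> with \<open>x \<in> D\<close> and \<open>l x \<le> z \<le> u x\<close>, given together with
  \<open>u\<close>, \<open>l\<close>, \<open>D\<close>.  It is represented by these data; \<open>u\<close> and \<open>l\<close> are total functions of which only
  the values on \<open>D\<close> matter.\<close>

definition is_corridor :: "(real ^ 'm \<Rightarrow> real) \<Rightarrow> (real ^ 'm \<Rightarrow> real) \<Rightarrow> (real ^ 'm) set \<Rightarrow> bool" where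
  "is_corridor u l D \<longleftrightarrow>
     full_dim_polytope D \<and> continuous_on D u \<and> continuous_on D l \<and> (\<forall>x\<in>D. l x < u x)"

text \<open>``Linear'' is meant in the sense of ``affine'', unlike the library's \<open>linear\<close>.\<close>

definition linear_function :: "(real ^ 'm \<Rightarrow> real) \<Rightarrow> bool" where
  "linear_function L \<longleftrightarrow> (\<exists>a b. L = (\<lambda>x. a \<bullet> x + b))"

text \<open>The pieces \<open>P i\<close> have to cover \<open>D\<close> but may reach beyond it.  Where pieces meet, the value is the
  minimum over all pieces containing the point.\<close>

definition piecewise_linear ::
    "nat \<Rightarrow> (real ^ 'm) set \<Rightarrow> (real ^ 'm \<Rightarrow> real) \<Rightarrow> bool" where
  "piecewise_linear n D g \<longleftrightarrow> n \<ge> 1 \<and>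
     (\<exists>P L. (\<forall>i\<in>{1..n}. full_dim_polytope (P i) \<and> linear_function (L i)) \<and>
        D \<subseteq> (\<Union>i\<in>{1..n}. P i) \<and>
        disjoint_family_on (\<lambda>i. interior (P i)) {1..n} \<and>
        (\<forall>x\<in>D. \<forall>i\<in>{1..n}. x \<in> interior (P i) \<longrightarrow> g x = L i x) \<and>
        (\<forall>x\<in>D. (\<exists>i\<in>{1..n}. x \<in> frontier (P i)) \<longrightarrow>
           g x = Min {L i x | i. i \<in> {1..n} \<and> x \<in> P i}))"

definition CFP_feasible ::
    "(real ^ 'm \<Rightarrow> real) \<Rightarrow> (real ^ 'm \<Rightarrow> real) \<Rightarrow> (real ^ 'm) set \<Rightarrow> nat \<Rightarrow> bool" where
  "CFP_feasible u l D n \<longleftrightarrow>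
     (\<exists>g. piecewise_linear n D g \<and> (\<forall>x\<in>D. l x \<le> g x \<and> g x \<le> u x))"

text \<open>Optimal values of minimization problems are infima in \<^typ>\<open>enat\<close>.  Such an infimum is the minimum
  whenever the problem is feasible, and \<open>\<infinity>\<close> otherwise.\<close>

definition z_CFP ::
    "(real ^ 'm \<Rightarrow> real) \<Rightarrow> (real ^ 'm \<Rightarrow> real) \<Rightarrow> (real ^ 'm) set \<Rightarrow> enat" where
  "z_CFP u l D = Inf {enat n | n. CFP_feasible u l D n}"


section \<open>Hypergraphs and incompatibility\<close>

definition hypergraph :: "'v set \<Rightarrow> 'v set set \<Rightarrow> bool" where
  "hypergraph V E \<longleftrightarrow> finite V \<and> (\<forall>e\<in>E. e \<subseteq> V)"

definition is_coloring :: "'v set \<Rightarrow> 'v set set \<Rightarrow> nat \<Rightarrow> ('v \<Rightarrow> nat) \<Rightarrow> bool" where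
  "is_coloring V E n c \<longleftrightarrow>
     (\<forall>v\<in>V. c v \<in> {1..n}) \<and> (\<forall>e\<in>E. \<exists>v\<in>e. \<exists>w\<in>e. c v \<noteq> c w)"

definition linearly_compatible ::
    "(real ^ 'm \<Rightarrow> real) \<Rightarrow> (real ^ 'm \<Rightarrow> real) \<Rightarrow> (real ^ 'm) set \<Rightarrow> bool" where
  "linearly_compatible u l s \<longleftrightarrow>
     (\<exists>L. linear_function L \<and> (\<forall>x\<in>convex hull s. l x \<le> L x \<and> L x \<le> u x))"

definition incompatibility_hypergraph ::
    "(real ^ 'm \<Rightarrow> real) \<Rightarrow> (real ^ 'm \<Rightarrow> real) \<Rightarrow> (real ^ 'm) set \<Rightarrow>
     (real ^ 'm) set \<Rightarrow> (real ^ 'm) set set \<Rightarrow> bool" where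
  "incompatibility_hypergraph u l D X E \<longleftrightarrow>
     hypergraph X E \<and> X \<subseteq> D \<and> (\<forall>e\<in>E. \<not> linearly_compatible u l e)"


section \<open>The relaxations\<close>

definition z_color :: "'v set \<Rightarrow> 'v set set \<Rightarrow> enat" where
  "z_color V E = Inf {enat n | n. \<exists>c. is_coloring V E n c}"

definition DCFP_feasible ::
    "(real ^ 'm \<Rightarrow> real) \<Rightarrow> (real ^ 'm \<Rightarrow> real) \<Rightarrow>
     (real ^ 'm) set \<Rightarrow> (real ^ 'm) set set \<Rightarrow> nat \<Rightarrow> bool" where
  "DCFP_feasible u l X E n \<longleftrightarrow>
     (\<exists>c a b. is_coloring X E n c \<and>
        disjoint_family_on (\<lambda>j. interior (convex hull {x \<in> X. c x = j})) {1..n} \<and>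
        (\<forall>x\<in>X. l x \<le> a (c x) \<bullet> x + b (c x) \<and> a (c x) \<bullet> x + b (c x) \<le> u x))"

definition z_DCFP ::
    "(real ^ 'm \<Rightarrow> real) \<Rightarrow> (real ^ 'm \<Rightarrow> real) \<Rightarrow>
     (real ^ 'm) set \<Rightarrow> (real ^ 'm) set set \<Rightarrow> enat" where
  "z_DCFP u l X E = Inf {enat n | n. DCFP_feasible u l X E n}"

definition graph_edges :: "'v set set \<Rightarrow> 'v set set" where
  "graph_edges E = {e \<in> E. \<not> card e \<ge> 3}"

definition is_clique :: "'v set \<Rightarrow> 'v set set \<Rightarrow> 'v set \<Rightarrow> bool" where
  "is_clique V F K \<longleftrightarrow> K \<subseteq> V \<and> clique K F"

definition is_maximal_clique :: "'v set \<Rightarrow> 'v set set \<Rightarrow> 'v set \<Rightarrow> bool" where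
  "is_maximal_clique V F K \<longleftrightarrow> is_clique V F K \<and> \<not> (\<exists>K'. is_clique V F K' \<and> K \<subset> K')"

definition z_MumC :: "'v set \<Rightarrow> 'v set set \<Rightarrow> nat" where
  "z_MumC V E = Max {card K | K. is_clique V (graph_edges E) K}"

end

theory Submission
  imports Defs
begin

text \<open>
  Each of the inequalities between minima holds because every feasible solution of the stronger
  problem yields a feasible solution of the weaker one with the same number of colors.

  The step from the Corridor Fitting Problem to the constrained coloring problem carries the
  content.  Given pieces \<open>P i\<close> and affine functions \<open>L i\<close>, one would like to color a point by a piece
  that contains it.  This is too weak where pieces meet: a piece may touch \<open>D\<close> in boundary points
  only, and its affine function need not respect the corridor there, since a piecewise linear
  function takes a minimum at such points.  A point is instead given a color \<open>i\<close> for which it lies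
  in the core \<open>closure (interior (P i) \<inter> interior D)\<close>.  Three facts make this work.  The cores
  cover \<open>D\<close>, because boundaries of convex sets are negligible (lemma
  \<open>convex_cover_by_closed_cores\<close>).  On each core, \<open>L i\<close> stays inside the corridor, because it
  agrees with the fitted function on a dense subset and \<open>u\<close>, \<open>l\<close> are continuous (lemma
  \<open>corridor_bounds_on_closure\<close>).  Each core is convex and contained in \<open>P i\<close>; hence the hull of a
  color class lies in a single piece, so that these hulls have disjoint interiors, and a set of
  points of one color is linearly compatible and so cannot be an edge.

  The bound by cliques is the usual one: a coloring is injective on a clique.
\<close>

section \<open>Fitted functions induce colorings\<close>

text \<open>The points of \<open>interior D\<close> outside all the closures form an open set.  All of them lie on the
  frontier of some \<open>P i\<close>, so this open set is negligible, hence empty.\<close>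

lemma convex_cover_by_closed_cores:
  fixes D :: "'a::euclidean_space set" and P :: "'i \<Rightarrow> 'a set"
  assumes "finite I" and "convex D" and "interior D \<noteq> {}"
    and convP: "\<And>i. i \<in> I \<Longrightarrow> convex (P i)"
    and cover: "D \<subseteq> (\<Union>i\<in>I. P i)"
  shows "D \<subseteq> (\<Union>i\<in>I. closure (interior (P i) \<inter> interior D))"
proof -
  let ?C = "\<Union>i\<in>I. closure (interior (P i) \<inter> interior D)"
  have closedC: "closed ?C"
    using \<open>finite I\<close> by (intro closed_UN) auto
  have "interior D - ?C \<subseteq> (\<Union>i\<in>I. frontier (P i))"
  proof
    fix x assume x: "x \<in> interior D - ?C"
    then have "x \<in> D"
      using interior_subset[of D] by blast
    then obtain i where i: "i \<in> I" "x \<in> P i"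
      using cover by blast
    have "x \<notin> interior (P i)"
      using x i closure_subset[of "interior (P i) \<inter> interior D"] by blast
    then show "x \<in> (\<Union>i\<in>I. frontier (P i))"
      using i closure_subset[of "P i"] by (auto simp: frontier_def)
  qed
  moreover have "negligible (\<Union>i\<in>I. frontier (P i))"
    using \<open>finite I\<close> convP by (intro negligible_Union) (auto intro: negligible_convex_frontier)
  ultimately have "negligible (interior D - ?C)"
    using negligible_subset by blast
  moreover have "open (interior D - ?C)"
    using closedC by (intro open_Diff) auto
  ultimately have "interior D \<subseteq> ?C"
    using open_not_negligible by blast
  then have "closure (interior D) \<subseteq> ?C"
    using closedC by (rule closure_minimal)
  then show ?thesis
    using convex_closure_interior[OF \<open>convex D\<close> \<open>interior D \<noteq> {}\<close>] closure_subset[of D] by blast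
qed

lemma corridor_bounds_on_closure:
  fixes u l L :: "'a::topological_space \<Rightarrow> real"
  assumes "continuous_on D u" "continuous_on D l" "continuous_on D L"
    and "closure S \<subseteq> D"
    and bounds: "\<And>x. x \<in> S \<Longrightarrow> l x \<le> L x \<and> L x \<le> u x"
    and "x \<in> closure S"
  shows "l x \<le> L x \<and> L x \<le> u x"
proof -
  have cont: "continuous_on (closure S) (\<lambda>x. L x - l x)" "continuous_on (closure S) (\<lambda>x. u x - L x)"
    using assms by (auto intro!: continuous_intros intro: continuous_on_subset)
  have "0 \<le> L x - l x"
    by (rule continuous_ge_on_closure[OF cont(1) \<open>x \<in> closure S\<close>]) (use bounds in auto)
  moreover have "0 \<le> u x - L x"
    by (rule continuous_ge_on_closure[OF cont(2) \<open>x \<in> closure S\<close>]) (use bounds in auto)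
  ultimately show ?thesis by simp
qed

lemma linear_function_continuous_on: "linear_function L \<Longrightarrow> continuous_on S L"
  unfolding linear_function_def by (auto intro!: continuous_intros)

text \<open>This excludes the empty edge, whose presence would make every coloring infeasible.\<close>

lemma linearly_compatible_empty: "linearly_compatible u l {}"
proof -
  have "linear_function (\<lambda>x. 0 \<bullet> x + 0)"
    unfolding linear_function_def by blast
  then show ?thesis
    unfolding linearly_compatible_def convex_hull_empty by blast
qed

lemma CFP_feasible_imp_DCFP_feasible:
  fixes u l :: "real ^ 'm \<Rightarrow> real"
  assumes corr: "is_corridor u l D"
    and incomp: "incompatibility_hypergraph u l D X E"
    and "CFP_feasible u l D n"
  shows "DCFP_feasible u l X E n"
proof -
  obtain g where g: "piecewise_linear n D g" "\<forall>x\<in>D. l x \<le> g x \<and> g x \<le> u x"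
    using \<open>CFP_feasible u l D n\<close> unfolding CFP_feasible_def by blast
  obtain P L where
    PL: "\<forall>i\<in>{1..n}. full_dim_polytope (P i) \<and> linear_function (L i)"
    and cover: "D \<subseteq> (\<Union>i\<in>{1..n}. P i)"
    and disj: "disjoint_family_on (\<lambda>i. interior (P i)) {1..n}"
    and gL: "\<forall>x\<in>D. \<forall>i\<in>{1..n}. x \<in> interior (P i) \<longrightarrow> g x = L i x"
    using g(1) unfolding piecewise_linear_def by (elim conjE exE) (rule that)
  then have P: "polytope (P i)" and L: "linear_function (L i)" if "i \<in> {1..n}" for i
    using that by (auto simp: full_dim_polytope_def)
  have "polytope D" and aff: "aff_dim D = int DIM(real ^ 'm)"
    and cont: "continuous_on D u" "continuous_on D l"
    using corr unfolding is_corridor_def full_dim_polytope_def by auto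
  then have "convex D" "closed D"
    using polytope_imp_convex polytope_imp_closed by auto
  have "interior D \<noteq> {}"
    using aff \<open>convex D\<close> rel_interior_eq_empty[of D] interior_rel_interior_gen[of D] by force
  have XD: "X \<subseteq> D" and EX: "\<And>e. e \<in> E \<Longrightarrow> e \<subseteq> X"
    and notcomp: "\<And>e. e \<in> E \<Longrightarrow> \<not> linearly_compatible u l e"
    using incomp unfolding incompatibility_hypergraph_def hypergraph_def by auto
  define Q where "Q i = closure (interior (P i) \<inter> interior D)" for i
  have convQ: "convex (Q i)" if "i \<in> {1..n}" for i
    unfolding Q_def using P[OF that] \<open>convex D\<close>
    by (intro convex_closure convex_Int convex_interior) (auto simp: polytope_imp_convex)
  have QD: "Q i \<subseteq> D" for i
    unfolding Q_def using \<open>closed D\<close> interior_subset by (intro closure_minimal) auto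
  have QP: "Q i \<subseteq> P i" if "i \<in> {1..n}" for i
    unfolding Q_def using polytope_imp_closed[OF P[OF that]] interior_subset
    by (intro closure_minimal) auto
  have Qbounds: "l x \<le> L i x \<and> L i x \<le> u x" if "i \<in> {1..n}" "x \<in> Q i" for i x
  proof (rule corridor_bounds_on_closure[OF cont linear_function_continuous_on[OF L[OF that(1)]]])
    show "closure (interior (P i) \<inter> interior D) \<subseteq> D" using QD unfolding Q_def .
    show "x \<in> closure (interior (P i) \<inter> interior D)" using that unfolding Q_def by simp
    show "l y \<le> L i y \<and> L i y \<le> u y" if "y \<in> interior (P i) \<inter> interior D" for y
      using that g(2) gL \<open>i \<in> {1..n}\<close> interior_subset by fastforce
  qed
  have "D \<subseteq> (\<Union>i\<in>{1..n}. Q i)"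
    unfolding Q_def
    by (rule convex_cover_by_closed_cores)
      (use \<open>convex D\<close> \<open>interior D \<noteq> {}\<close> cover P polytope_imp_convex in auto)
  then have "\<forall>x\<in>X. \<exists>i\<in>{1..n}. x \<in> Q i"
    using XD by blast
  then obtain c where c: "\<And>x. x \<in> X \<Longrightarrow> c x \<in> {1..n}" "\<And>x. x \<in> X \<Longrightarrow> x \<in> Q (c x)"
    by metis
  have "\<forall>i\<in>{1..n}. \<exists>a b. L i = (\<lambda>x. a \<bullet> x + b)"
    using L unfolding linear_function_def by blast
  then obtain a b where ab: "\<And>i. i \<in> {1..n} \<Longrightarrow> L i = (\<lambda>x. a i \<bullet> x + b i)"
    by metis
  have "is_coloring X E n c"
    unfolding is_coloring_def
  proof (intro conjI ballI)
    fix e assume e: "e \<in> E"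
    show "\<exists>v\<in>e. \<exists>w\<in>e. c v \<noteq> c w"
    proof (rule ccontr)
      assume mono: "\<not> (\<exists>v\<in>e. \<exists>w\<in>e. c v \<noteq> c w)"
      have "e \<noteq> {}"
        using notcomp[OF e] linearly_compatible_empty by blast
      then obtain v where v: "v \<in> e" by blast
      then have i: "c v \<in> {1..n}" using c(1) EX[OF e] by blast
      have "e \<subseteq> Q (c v)"
      proof
        fix w assume w: "w \<in> e"
        then have "c v = c w" using mono v by blast
        moreover have "w \<in> Q (c w)" using w c(2) EX[OF e] by blast
        ultimately show "w \<in> Q (c v)" by simp
      qed
      then have "convex hull e \<subseteq> Q (c v)" using convQ[OF i] by (rule hull_minimal)
      then have "linearly_compatible u l e"
        unfolding linearly_compatible_def using L[OF i] Qbounds[OF i] by blast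
      with notcomp[OF e] show False by blast
    qed
  qed (rule c(1))
  moreover have "disjoint_family_on (\<lambda>j. interior (convex hull {x \<in> X. c x = j})) {1..n}"
  proof -
    have "interior (convex hull {x \<in> X. c x = j}) \<subseteq> interior (P j)" if "j \<in> {1..n}" for j
    proof (rule interior_mono)
      show "convex hull {x \<in> X. c x = j} \<subseteq> P j"
      proof (rule hull_minimal)
        show "{x \<in> X. c x = j} \<subseteq> P j" using c(2) QP[OF that] by blast
        show "convex (P j)" using polytope_imp_convex[OF P[OF that]] .
      qed
    qed
    then show ?thesis
      using disj unfolding disjoint_family_on_def by blast
  qed
  moreover have "\<forall>x\<in>X. l x \<le> a (c x) \<bullet> x + b (c x) \<and> a (c x) \<bullet> x + b (c x) \<le> u x"
  proof
    fix x assume "x \<in> X"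
    then show "l x \<le> a (c x) \<bullet> x + b (c x) \<and> a (c x) \<bullet> x + b (c x) \<le> u x"
      using Qbounds[OF c(1) c(2)] ab[OF c(1)] by simp
  qed
  ultimately show ?thesis
    unfolding DCFP_feasible_def by blast
qed

section \<open>Cliques bound the number of colors\<close>

lemma coloring_inj_on_clique:
  assumes "is_coloring V E n c" and "is_clique V (graph_edges E) K"
  shows "inj_on c K"
proof (rule inj_onI, rule ccontr)
  fix v w assume vw: "v \<in> K" "w \<in> K" "c v = c w" "v \<noteq> w"
  then have "{v, w} \<in> E"
    using assms(2) unfolding is_clique_def clique_def graph_edges_def by blast
  then obtain x y where "x \<in> {v, w}" "y \<in> {v, w}" "c x \<noteq> c y"
    using assms(1) unfolding is_coloring_def by blast
  with vw show False by auto
qed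

lemma card_clique_le_colors:
  assumes "is_coloring V E n c" and "is_clique V (graph_edges E) K"
  shows "card K \<le> n"
proof -
  have "c ` K \<subseteq> {1..n}"
    using assms unfolding is_coloring_def is_clique_def by blast
  then have "card K \<le> card {1..n}"
    using card_inj_on_le[OF coloring_inj_on_clique[OF assms]] by blast
  then show ?thesis by simp
qed

lemma finite_clique_cards: "finite V \<Longrightarrow> finite {card K | K. is_clique V F K}"
  by (rule finite_subset[of _ "card ` Pow V"]) (auto simp: is_clique_def)

lemma z_MumC_attained:
  assumes "finite V"
  obtains K where "is_clique V (graph_edges E) K" and "card K = z_MumC V E"
proof -
  have "is_clique V (graph_edges E) {}"
    by (simp add: is_clique_def clique_def)
  then have "z_MumC V E \<in> {card K | K. is_clique V (graph_edges E) K}"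
    unfolding z_MumC_def using finite_clique_cards[OF assms] by (intro Max_in) auto
  then show thesis using that by auto
qed

lemma card_clique_le_z_MumC:
  assumes "finite V" and "is_clique V (graph_edges E) K"
  shows "card K \<le> z_MumC V E"
  unfolding z_MumC_def using finite_clique_cards[OF assms(1)] assms(2) by (intro Max_ge) auto

section \<open>The chain of relaxations\<close>

theorem proposition17:
  fixes u l :: "real ^ 'm \<Rightarrow> real"
    and D X :: "(real ^ 'm) set"
    and E :: "(real ^ 'm) set set"
  assumes "is_corridor u l D"
    and "finite X" and "X \<subseteq> D"
    and "incompatibility_hypergraph u l D X E"
  shows "z_CFP u l D \<ge> z_DCFP u l X E \<and>
         z_DCFP u l X E \<ge> z_color X E \<and>
         z_color X E \<ge> enat (z_MumC X E) \<and>
         (\<forall>K. is_maximal_clique X (graph_edges E) K \<longrightarrow> z_MumC X E \<ge> card K)"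
proof (intro conjI allI impI)
  show "z_CFP u l D \<ge> z_DCFP u l X E"
    unfolding z_CFP_def z_DCFP_def
    using CFP_feasible_imp_DCFP_feasible[OF assms(1,4)] by (intro Inf_superset_mono) blast
  show "z_DCFP u l X E \<ge> z_color X E"
    unfolding z_DCFP_def z_color_def DCFP_feasible_def by (intro Inf_superset_mono) blast
  obtain K where "is_clique X (graph_edges E) K" "card K = z_MumC X E"
    using z_MumC_attained[OF \<open>finite X\<close>] .
  then have "z_MumC X E \<le> n" if "is_coloring X E n c" for n c
    using card_clique_le_colors[OF that] by metis
  then show "z_color X E \<ge> enat (z_MumC X E)"
    unfolding z_color_def by (intro Inf_greatest) auto
  show "z_MumC X E \<ge> card K" if "is_maximal_clique X (graph_edges E) K" for K
    using that card_clique_le_z_MumC[OF \<open>finite X\<close>] unfolding is_maximal_clique_def by blast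
qed

end
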